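(* There exists a single-sample mechanism that satisfies dominant strategy incentive compatibility (DSIC), individual rationality (IR), and weak budget balance (WBB). Moreover, when all participants report truthfully, the mechanism achieves, in expectation over independent draws $\rho_j\sim G_j$ (sellers' valuations) and $\rho^s_j\sim G_j$ (samples), a liquid welfare of at least $1/4$ of the expected optimal liquid welfare, i.e. $\mathbb E_{\rho,\rho^s\sim G}[{\rm LW}]\ge \frac14\,\mathbb E_{\rho\sim G}[{\rm LW}^{\rm OPT}(\rho)]$, and a social welfare of at least $1/2$ of the expected optimal liquid welfare, i.e. $\mathbb E_{\rho,\rho^s\sim G}[{\rm SW}]\ge \frac12\,\mathbb E_{\rho\sim G}[{\rm LW}^{\rm OPT}(\rho)]$.
   Context: Market model. There are buyers $N=\{1,\dots,n\}$ and sellers $M=\{1,\dots,m\}$ and a bipartite graph with edge set $E\subseteq N\times M$; an edge $(i,j)$ is written $ij$, and for a set $S$ of participants $E_S$ is the set of edges incident to a member of $S$ ($E_i:=E_{\{i\}}$). For $w\in\mathbb R^E$ and $F\subseteq E$, $w(F)=\sum_{e\in F}w_e$. Each seller $j$ has a monotone submodular function $f_j:2^{E_j}\to\mathbb R_+$ with $f_j(\emptyset)=0$ and polymatroid $P_j=\{y\in\mathbb R^{E_j}_+: y(F)\le f_j(F)\ \forall F\subseteq E_j\}$; $f_j(E_j)$ is the total amount of a homogeneous divisible good owned by $j$. Let $P=\{w\in\mathbb R^E_+: w|_{E_j}\in P_j\ \forall j\in M\}$. Buyer $i$ has a private per-unit valuation $v_i>0$ and a (publicly reported) budget $B_i\ge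 0$; seller $j$ has a private per-unit valuation $\rho_j>0$. An allocation is $(w,p,r)$ with transaction vector $w\in P$ ($w_{ij}$ = amount seller $j$ transfers to buyer $i$), payments $p_i\le B_i$ and seller revenues $r_j$; set $x_i=w(E_i)$ for $i\in N$ and $x_j=f_j(E_j)-w(E_j)$ for $j\in M$. Liquid welfare ${\rm LW}=\sum_{i\in N}\min(v_ix_i,B_i)+\sum_{j\in M}\rho_jx_j$; social welfare ${\rm SW}=\sum_{i\in N}v_ix_i+\sum_{j\in M}\rho_jx_j$; ${\rm LW}^{\rm OPT}(\rho)$ is the maximum of LW over all $w\in P$ when sellers' valuations are $\rho$. Single-sample setting. Each seller's valuation $\rho_j$ is drawn independently from an unknown distribution $G_j$ on $\mathbb R_{>0}$, and the auctioneer additionally receives one independent sample $\rho^s_j\sim G_j$ for each seller, but does not know $G=(G_j)_j$. A single-sample mechanism maps the information (the graph, buyers' bids $v'$, budgets $B$, sellers' bids $\rho'$, samples $\rho^s$, and $P$) to an allocation. Utilities: buyer $i$ gets $v_ix_i-p_i$ if $p_i\le B_i$ and $-\infty$ otherwise; seller $j$ gets $r_j-\rho_j(f_j(E_j)-x_j)$. DSIC: for every input, each participant maximizes her utility by bidding her true valuation, whatever the others bid. IR: bidding truthfully yields nonnegative utility. WBB: $\sum_{i}p_i\ge\sum_j r_j$. The LW and SW of the mechanism are evaluated at the true valuations. *)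

theory Defs
  imports "HOL-Probability.Probability"
begin

definition seller_edges :: "('b \<times> 's) set \<Rightarrow> 's \<Rightarrow> ('b \<times> 's) set" where
  "seller_edges E j = {e \<in> E. snd e = j}"

definition buyer_edges :: "('b \<times> 's) set \<Rightarrow> 'b \<Rightarrow> ('b \<times> 's) set" where
  "buyer_edges E i = {e \<in> E. fst e = i}"

definition polymatroid_fn :: "'e set \<Rightarrow> ('e set \<Rightarrow> real) \<Rightarrow> bool" where
  "polymatroid_fn Ej g \<longleftrightarrow>
     g {} = 0 \<and>
     (\<forall>S. S \<subseteq> Ej \<longrightarrow> 0 \<le> g S) \<and>
     (\<forall>S T. S \<subseteq> T \<and> T \<subseteq> Ej \<longrightarrow> g S \<le> g T) \<and>
     (\<forall>S T. S \<subseteq> Ej \<and> T \<subseteq> Ej \<longrightarrow> g (S \<union> T) + g (S \<inter> T) \<le> g S + g T)"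

definition valid_market ::
  "'b set \<Rightarrow> 's set \<Rightarrow> ('b \<times> 's) set \<Rightarrow> ('s \<Rightarrow> ('b \<times> 's) set \<Rightarrow> real) \<Rightarrow> bool" where
  "valid_market N M E f \<longleftrightarrow> finite N \<and> finite M \<and> E \<subseteq> N \<times> M \<and>
     (\<forall>j\<in>M. polymatroid_fn (seller_edges E j) (f j))"

definition in_P ::
  "'s set \<Rightarrow> ('b \<times> 's) set \<Rightarrow> ('s \<Rightarrow> ('b \<times> 's) set \<Rightarrow> real) \<Rightarrow> ('b \<times> 's \<Rightarrow> real) \<Rightarrow> bool" where
  "in_P M E f w \<longleftrightarrow> (\<forall>e\<in>E. 0 \<le> w e) \<and> (\<forall>e. e \<notin> E \<longrightarrow> w e = 0) \<and>
     (\<forall>j\<in>M. \<forall>F. F \<subseteq> seller_edges E j \<longrightarrow> sum w F \<le> f j F)"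

type_synonym ('b, 's) alloc = "('b \<times> 's \<Rightarrow> real) \<times> ('b \<Rightarrow> real) \<times> ('s \<Rightarrow> real)"

definition feasible_alloc ::
  "'b set \<Rightarrow> 's set \<Rightarrow> ('b \<times> 's) set \<Rightarrow> ('s \<Rightarrow> ('b \<times> 's) set \<Rightarrow> real) \<Rightarrow> ('b \<Rightarrow> real)
     \<Rightarrow> ('b, 's) alloc \<Rightarrow> bool" where
  "feasible_alloc N M E f B a \<longleftrightarrow>
     (case a of (w, p, r) \<Rightarrow> in_P M E f w \<and> (\<forall>i\<in>N. p i \<le> B i))"

definition buyer_amount :: "('b \<times> 's) set \<Rightarrow> ('b \<times> 's \<Rightarrow> real) \<Rightarrow> 'b \<Rightarrow> real" where
  "buyer_amount E w i = sum w (buyer_edges E i)"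

definition seller_amount ::
  "('b \<times> 's) set \<Rightarrow> ('s \<Rightarrow> ('b \<times> 's) set \<Rightarrow> real) \<Rightarrow> ('b \<times> 's \<Rightarrow> real) \<Rightarrow> 's \<Rightarrow> real" where
  "seller_amount E f w j = f j (seller_edges E j) - sum w (seller_edges E j)"

definition liquid_welfare ::
  "'b set \<Rightarrow> 's set \<Rightarrow> ('b \<times> 's) set \<Rightarrow> ('s \<Rightarrow> ('b \<times> 's) set \<Rightarrow> real) \<Rightarrow> ('b \<Rightarrow> real)
     \<Rightarrow> ('b \<Rightarrow> real) \<Rightarrow> ('s \<Rightarrow> real) \<Rightarrow> ('b \<times> 's \<Rightarrow> real) \<Rightarrow> real" where
  "liquid_welfare N M E f B v \<rho> w =
     (\<Sum>i\<in>N. min (v i * buyer_amount E w i) (B i)) + (\<Sum>j\<in>M. \<rho> j * seller_amount E f w j)"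

definition social_welfare ::
  "'b set \<Rightarrow> 's set \<Rightarrow> ('b \<times> 's) set \<Rightarrow> ('s \<Rightarrow> ('b \<times> 's) set \<Rightarrow> real)
     \<Rightarrow> ('b \<Rightarrow> real) \<Rightarrow> ('s \<Rightarrow> real) \<Rightarrow> ('b \<times> 's \<Rightarrow> real) \<Rightarrow> real" where
  "social_welfare N M E f v \<rho> w =
     (\<Sum>i\<in>N. v i * buyer_amount E w i) + (\<Sum>j\<in>M. \<rho> j * seller_amount E f w j)"

definition LW_OPT ::
  "'b set \<Rightarrow> 's set \<Rightarrow> ('b \<times> 's) set \<Rightarrow> ('s \<Rightarrow> ('b \<times> 's) set \<Rightarrow> real) \<Rightarrow> ('b \<Rightarrow> real)
     \<Rightarrow> ('b \<Rightarrow> real) \<Rightarrow> ('s \<Rightarrow> real) \<Rightarrow> real" where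
  "LW_OPT N M E f B v \<rho> = (SUP w \<in> {w. in_P M E f w}. liquid_welfare N M E f B v \<rho> w)"

(* utilities; the budget violation case (-\<infinity>) cannot occur for feasible allocations *)
definition buyer_utility :: "('b \<times> 's) set \<Rightarrow> real \<Rightarrow> 'b \<Rightarrow> ('b, 's) alloc \<Rightarrow> real" where
  "buyer_utility E vi i a = (case a of (w, p, r) \<Rightarrow> vi * buyer_amount E w i - p i)"

definition seller_utility :: "('b \<times> 's) set \<Rightarrow> real \<Rightarrow> 's \<Rightarrow> ('b, 's) alloc \<Rightarrow> real" where
  "seller_utility E \<rho>j j a = (case a of (w, p, r) \<Rightarrow> r j - \<rho>j * sum w (seller_edges E j))"

(* A single-sample mechanism: input = graph (N, M, E), polymatroids (given by f),
   budgets B, buyers' bids v', sellers' bids rho', samples rho^s. *)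
type_synonym ('b, 's) mechanism =
  "'b set \<Rightarrow> 's set \<Rightarrow> ('b \<times> 's) set \<Rightarrow> ('s \<Rightarrow> ('b \<times> 's) set \<Rightarrow> real) \<Rightarrow> ('b \<Rightarrow> real)
     \<Rightarrow> ('b \<Rightarrow> real) \<Rightarrow> ('s \<Rightarrow> real) \<Rightarrow> ('s \<Rightarrow> real) \<Rightarrow> ('b, 's) alloc"

definition admissible_input ::
  "'b set \<Rightarrow> 's set \<Rightarrow> ('b \<times> 's) set \<Rightarrow> ('s \<Rightarrow> ('b \<times> 's) set \<Rightarrow> real) \<Rightarrow> ('b \<Rightarrow> real)
     \<Rightarrow> ('b \<Rightarrow> real) \<Rightarrow> ('s \<Rightarrow> real) \<Rightarrow> ('s \<Rightarrow> real) \<Rightarrow> bool" where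
  "admissible_input N M E f B v' \<rho>' \<rho>s \<longleftrightarrow> valid_market N M E f \<and> (\<forall>i\<in>N. 0 \<le> B i) \<and>
     (\<forall>i\<in>N. 0 < v' i) \<and> (\<forall>j\<in>M. 0 < \<rho>' j) \<and> (\<forall>j\<in>M. 0 < \<rho>s j)"

definition is_mechanism :: "('b, 's) mechanism \<Rightarrow> bool" where
  "is_mechanism mech \<longleftrightarrow> (\<forall>N M E f B v' \<rho>' \<rho>s. admissible_input N M E f B v' \<rho>' \<rho>s \<longrightarrow>
      feasible_alloc N M E f B (mech N M E f B v' \<rho>' \<rho>s))"

definition DSIC :: "('b, 's) mechanism \<Rightarrow> bool" where
  "DSIC mech \<longleftrightarrow> (\<forall>N M E f B v' \<rho>' \<rho>s. admissible_input N M E f B v' \<rho>' \<rho>s \<longrightarrow>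
      (\<forall>i\<in>N. \<forall>d>0. buyer_utility E (v' i) i (mech N M E f B (v'(i := d)) \<rho>' \<rho>s)
                    \<le> buyer_utility E (v' i) i (mech N M E f B v' \<rho>' \<rho>s)) \<and>
      (\<forall>j\<in>M. \<forall>d>0. seller_utility E (\<rho>' j) j (mech N M E f B v' (\<rho>'(j := d)) \<rho>s)
                    \<le> seller_utility E (\<rho>' j) j (mech N M E f B v' \<rho>' \<rho>s)))"

definition IR :: "('b, 's) mechanism \<Rightarrow> bool" where
  "IR mech \<longleftrightarrow> (\<forall>N M E f B v' \<rho>' \<rho>s. admissible_input N M E f B v' \<rho>' \<rho>s \<longrightarrow>
      (\<forall>i\<in>N. 0 \<le> buyer_utility E (v' i) i (mech N M E f B v' \<rho>' \<rho>s)) \<and>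
      (\<forall>j\<in>M. 0 \<le> seller_utility E (\<rho>' j) j (mech N M E f B v' \<rho>' \<rho>s)))"

definition WBB :: "('b, 's) mechanism \<Rightarrow> bool" where
  "WBB mech \<longleftrightarrow> (\<forall>N M E f B v' \<rho>' \<rho>s. admissible_input N M E f B v' \<rho>' \<rho>s \<longrightarrow>
      (case mech N M E f B v' \<rho>' \<rho>s of (w, p, r) \<Rightarrow> (\<Sum>j\<in>M. r j) \<le> (\<Sum>i\<in>N. p i)))"

definition positive_distribution :: "real measure \<Rightarrow> bool" where
  "positive_distribution D \<longleftrightarrow> prob_space D \<and> sets D = sets borel \<and> (AE x in D. 0 < x)"

end

theory Submission
  imports Defs
begin

text \<open>
  Seller \<open>j\<close> takes part if her bid is at most her sample, and then sells at the unit price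
  \<open>\<rho>\<^sup>s\<^sub>j\<close>. Among the trades of the participating sellers the mechanism maximises
  \<open>\<Sum>\<^sub>i \<phi>\<^sub>i(x\<^sub>i) - \<Sum>\<^sub>j \<rho>\<^sup>s\<^sub>j w(E\<^sub>j)\<close>, where the concave function \<open>\<phi>\<^sub>i\<close> has slope
  \<open>\<pi>\<^sub>i(x) = min(v\<^sub>i, B\<^sub>i/x)\<close> (an Eisenberg-Gale objective with quasi-linear buyers), and it charges
  every buyer her externality with respect to this objective.

  Everything follows from the first-order condition
  \<open>\<Sum>\<^sub>i \<pi>\<^sub>i(x\<^sub>i)(x'\<^sub>i - x\<^sub>i) \<le> cost(w') - cost(w)\<close> for all feasible \<open>w'\<close>. The externality is at most
  \<open>\<pi>\<^sub>i(x\<^sub>i) x\<^sub>i = min(v\<^sub>i x\<^sub>i, B\<^sub>i)\<close> and at least the cost of the units that buyer \<open>i\<close> receives. A buyer whose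
  budget does not bind gets her favourite quantity at convex prices; a buyer whose budget binds would
  like more, but no other bid gives her more, since \<open>B\<^sub>i/x\<close> decreases while marginal prices increase.

  For the welfare, \<open>Q(\<rho>, \<rho>\<^sup>s) = \<Sum>\<^sub>j \<rho>\<^sub>j f\<^sub>j(E\<^sub>j)\<close> plus the best liquid gain from trade with the participating
  sellers at prices \<open>\<rho>\<^sup>s\<close> satisfies \<open>SW \<ge> Q\<close> and \<open>2 LW \<ge> Q\<close>. For every \<open>j\<close>, seller \<open>j\<close> participates at
  \<open>(\<rho>, \<rho>\<^sup>s)\<close> or at \<open>(\<rho>\<^sup>s, \<rho>)\<close>, so splitting an optimal trade between the two gives
  \<open>Q(\<rho>, \<rho>\<^sup>s) + Q(\<rho>\<^sup>s, \<rho>) \<ge> LW\<^sup>O\<^sup>P\<^sup>T(\<rho>)\<close>, and both terms have the same expectation.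
\<close>

section \<open>Budget-capped concave values\<close>

text \<open>For \<open>B > 0\<close> and \<open>x > 0\<close> this is \<open>min(v, B/x)\<close>; the form chosen is continuous up to \<open>x = 0\<close> and
  vanishes for \<open>B = 0\<close>, as \<open>0/0 = 0\<close>.\<close>
definition budget_slope :: "real \<Rightarrow> real \<Rightarrow> real \<Rightarrow> real" where
  "budget_slope v B x = B / max x (B / v)"

text \<open>The integral of \<^const>\<open>budget_slope\<close> from \<open>0\<close> to \<open>x\<close>.\<close>
definition budget_value :: "real \<Rightarrow> real \<Rightarrow> real \<Rightarrow> real" where
  "budget_value v B x = v * min x (B / v) + B * ln (max x (B / v) / (B / v))"

lemma budget_value_tangent:
  assumes v: "0 < v" and B: "0 \<le> B" and x: "0 \<le> x" and y: "0 \<le> y"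
  shows "budget_value v B y \<le> budget_value v B x + budget_slope v B x * (y - x)"
proof (cases "B = 0")
  case True
  then show ?thesis using x y by (simp add: budget_value_def budget_slope_def)
next
  case False
  define k where "k = B / v"
  have k: "0 < k" and Bpos: "0 < B" and vk: "v = B / k"
    using False B v by (auto simp: k_def)
  have unit: "min (y/k) 1 + ln (max y k / k)
      \<le> min (x/k) 1 + ln (max x k / k) + (y - x) / max x k"
  proof (cases "x \<le> k"; cases "y \<le> k")
    assume "x \<le> k" "y \<le> k"
    then show ?thesis using k by (simp add: field_simps min_def max_def)
  next
    assume "x \<le> k" "\<not> y \<le> k"
    moreover have "ln (y / k) \<le> y / k - 1"
      using calculation k by (intro ln_le_minus_one) auto
    ultimately show ?thesis using k by (simp add: field_simps min_def max_def)
  next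
    assume a: "\<not> x \<le> k" "y \<le> k"
    have "ln (k / x) \<le> k / x - 1"
      using a k by (intro ln_le_minus_one) auto
    moreover have "ln (k / x) = - ln (x / k)"
      using a k by (simp add: ln_div)
    moreover have "y / k - y / x \<le> 1 - k / x"
    proof -
      have "(y / k) * (1 - k / x) \<le> 1 * (1 - k / x)"
        using a k y by (intro mult_right_mono) (auto simp: field_simps)
      moreover have "(y / k) * (1 - k / x) = y / k - y / x"
        using a k by (simp add: right_diff_distrib)
      ultimately show ?thesis by simp
    qed
    moreover have "(y - x) / x = y / x - 1"
      using a k by (simp add: field_simps)
    ultimately have "y / k \<le> 1 + ln (x / k) + (y - x) / x" by linarith
    then show ?thesis using a k by (simp add: min_def max_def)
  next
    assume a: "\<not> x \<le> k" "\<not> y \<le> k"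
    have "ln (y / x) \<le> y / x - 1"
      using a k by (intro ln_le_minus_one) auto
    moreover have "ln (y / x) = ln (y / k) - ln (x / k)"
      using a k by (simp add: ln_div)
    moreover have "(y - x) / x = y / x - 1"
      using a k by (simp add: field_simps)
    ultimately have "ln (y / k) \<le> ln (x / k) + (y - x) / x" by linarith
    then show ?thesis using a k by (simp add: min_def max_def)
  qed
  have eq: "budget_value v B z = B * (min (z/k) 1 + ln (max z k / k))" for z
    using k Bpos v by (auto simp: budget_value_def k_def[symmetric] vk min_def max_def field_simps)
  have "budget_slope v B x * (y - x) = B * ((y - x) / max x k)"
    by (simp add: budget_slope_def k_def)
  then show ?thesis
    using mult_left_mono[OF unit, of B] Bpos by (simp add: eq distrib_left)
qed

lemma continuous_on_budget_value:
  assumes v: "0 < v" and B: "0 \<le> B"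
  shows "continuous_on {0..} (budget_value v B)"
proof (cases "B = 0")
  case True
  have "continuous_on {0..} (\<lambda>x::real. 0::real)" by simp
  then show ?thesis
    by (rule continuous_on_cong[THEN iffD1, rotated 2]) (auto simp: budget_value_def True)
next
  case False
  then have "0 < B / v" using assms by simp
  then have "0 < max x (B / v) / (B / v)" for x
    by (intro divide_pos_pos[of _ "B / v"]) (auto simp: less_max_iff_disj)
  then have "max x (B / v) / (B / v) \<noteq> 0" for x
    by (metis less_irrefl)
  then show ?thesis unfolding budget_value_def
    using \<open>0 < B / v\<close> False v by (intro continuous_intros) (auto)
qed

lemma continuous_on_budget_slope:
  assumes v: "0 < v" and B: "0 \<le> B"
  shows "continuous_on UNIV (budget_slope v B)"
proof (cases "B = 0")
  case True
  then show ?thesis by (simp add: budget_slope_def [abs_def])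
next
  case False
  then have "0 < B / v" using assms by simp
  then show ?thesis unfolding budget_slope_def
    by (intro continuous_intros) (auto simp: max_def)
qed

context
  fixes v B x :: real
  assumes v: "0 < v" and B: "0 \<le> B" and x: "0 \<le> x"
begin

lemma budget_slope_nonneg: "0 \<le> budget_slope v B x"
  using B x by (simp add: budget_slope_def)

lemma budget_slope_le: "budget_slope v B x \<le> v"
proof (cases "B = 0")
  case False
  then have "0 < B / v" using B v by simp
  then have "B / max x (B / v) \<le> B / (B / v)"
    using B by (intro divide_left_mono mult_pos_pos) auto
  then show ?thesis using False v by (simp add: budget_slope_def)
qed (use v in \<open>simp add: budget_slope_def\<close>)

lemma budget_slope_mult: "budget_slope v B x * x = min (v * x) B"
proof (cases "B = 0")
  case False
  then have "0 < B / v" using B v by simp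
  then show ?thesis
    using False v B by (auto simp: budget_slope_def max_def min_def field_simps)
qed (use v x in \<open>simp add: budget_slope_def\<close>)

lemma capped_value_le_twice:
  assumes y: "0 \<le> y"
  shows "min (v * y) B \<le> budget_slope v B x * y + min (v * x) B"
proof (cases "v * x \<le> B \<and> 0 < B")
  case True
  then have "budget_slope v B x = v"
    using v by (auto simp: budget_slope_def max_def field_simps)
  moreover have "0 \<le> min (v * x) B" using x v B by simp
  ultimately show ?thesis by (simp add: min.coboundedI1)
next
  case False
  moreover have "0 \<le> v * x" using v x by simp
  ultimately have "min (v * x) B = B" using B by linarith
  then show ?thesis using y budget_slope_nonneg by (simp add: min_def add_increasing)
qed

lemma capped_value_le_linear:
  assumes y: "0 \<le> y"
  shows "min (v * y) B \<le> budget_slope v B x * y + (v - budget_slope v B x) * x"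
proof (cases "y \<le> x")
  case True
  have "(v - budget_slope v B x) * y \<le> (v - budget_slope v B x) * x"
    using budget_slope_le True by (intro mult_left_mono) auto
  then show ?thesis by (simp add: algebra_simps min_def)
next
  case False
  have "budget_slope v B x * x \<le> budget_slope v B x * y"
    using budget_slope_nonneg False by (intro mult_left_mono) auto
  moreover have "min (v * y) B \<le> v * x \<or> x < B / v \<and> 0 < B"
  proof (cases "B \<le> v * x")
    case False
    moreover have "0 \<le> v * x" using v x by simp
    ultimately show ?thesis using v by (simp add: field_simps)
  qed (simp add: min.coboundedI2)
  ultimately show ?thesis
  proof (elim disjE conjE)
    assume "x < B / v" "0 < B"
    then have "budget_slope v B x = v" using v by (simp add: budget_slope_def)
    then show ?thesis by simp
  qed (simp add: algebra_simps)
qed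

lemma budget_slope_strict_antimono:
  assumes "0 < B" "0 < d" "x < y" "budget_slope v B x < v"
  shows "budget_slope d B y < budget_slope v B x"
proof -
  have xk: "B / v < x"
  proof (rule ccontr)
    assume "\<not> B / v < x"
    then have "budget_slope v B x = v" using v assms(1) by (simp add: budget_slope_def)
    then show False using assms by simp
  qed
  moreover have "0 < B / v" using assms v by simp
  ultimately have "0 < x" by linarith
  have "budget_slope d B y \<le> B / y"
    unfolding budget_slope_def using assms \<open>0 < x\<close> by (intro divide_left_mono) (auto simp: max_def)
  also have "\<dots> < B / x" using assms \<open>0 < x\<close> by (intro divide_strict_left_mono) auto
  finally show ?thesis using xk by (simp add: budget_slope_def)
qed

end

section \<open>Clearing trades and externality payments\<close>

definition trade_cost :: "('b \<times> 's) set \<Rightarrow> ('s \<Rightarrow> real) \<Rightarrow> ('b \<times> 's \<Rightarrow> real) \<Rightarrow> real" where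
  "trade_cost E b w = (\<Sum>e\<in>E. b (snd e) * w e)"

definition surplus ::
  "'b set \<Rightarrow> ('b \<times> 's) set \<Rightarrow> ('b \<Rightarrow> real) \<Rightarrow> ('s \<Rightarrow> real) \<Rightarrow> ('b \<Rightarrow> real)
     \<Rightarrow> ('b \<times> 's \<Rightarrow> real) \<Rightarrow> real" where
  "surplus X E B b v w =
     (\<Sum>i\<in>X. budget_value (v i) (B i) (buyer_amount E w i)) - trade_cost E b w"

text \<open>First-order optimality for the surplus, in variational form.\<close>
definition clearing ::
  "'b set \<Rightarrow> ('b \<times> 's) set \<Rightarrow> ('b \<Rightarrow> real) \<Rightarrow> ('s \<Rightarrow> real) \<Rightarrow> ('b \<times> 's \<Rightarrow> real) set
     \<Rightarrow> ('b \<Rightarrow> real) \<Rightarrow> ('b \<times> 's \<Rightarrow> real) \<Rightarrow> bool" where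
  "clearing N E B b W v w \<longleftrightarrow> w \<in> W \<and>
     (\<forall>w'\<in>W. (\<Sum>i\<in>N. budget_slope (v i) (B i) (buyer_amount E w i)
                 * (buyer_amount E w' i - buyer_amount E w i))
             \<le> trade_cost E b w' - trade_cost E b w)"

definition externality ::
  "'b set \<Rightarrow> ('b \<times> 's) set \<Rightarrow> ('b \<Rightarrow> real) \<Rightarrow> ('s \<Rightarrow> real) \<Rightarrow> ('b \<times> 's \<Rightarrow> real) set
     \<Rightarrow> ('b \<Rightarrow> real) \<Rightarrow> ('b \<times> 's \<Rightarrow> real) \<Rightarrow> 'b \<Rightarrow> real" where
  "externality N E B b W v w i =
     (SUP w'\<in>W. surplus (N - {i}) E B b v w') - surplus (N - {i}) E B b v w"

locale auction =
  fixes N :: "'b set" and E :: "('b \<times> 's) set" and W :: "('b \<times> 's \<Rightarrow> real) set"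
    and B :: "'b \<Rightarrow> real" and b :: "'s \<Rightarrow> real"
  assumes finite_N: "finite N" and finite_E: "finite E" and E_buyers: "fst ` E \<subseteq> N"
    and budget_nonneg: "i \<in> N \<Longrightarrow> 0 \<le> B i"
    and price_pos: "e \<in> E \<Longrightarrow> 0 < b (snd e)"
    and W_nonempty: "W \<noteq> {}" and W_compact: "compact W"
    and W_nonneg: "w \<in> W \<Longrightarrow> e \<in> E \<Longrightarrow> 0 \<le> w e"
    and W_convex: "w \<in> W \<Longrightarrow> w' \<in> W \<Longrightarrow> 0 \<le> l \<Longrightarrow> l \<le> 1 \<Longrightarrow> (\<lambda>e. w e + l * (w' e - w e)) \<in> W"
    and W_drop: "w \<in> W \<Longrightarrow> (\<lambda>e. if fst e = i then 0 else w e) \<in> W"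
begin

abbreviation "amount \<equiv> buyer_amount E"
abbreviation "cost \<equiv> trade_cost E b"

lemma amount_nonneg: "w \<in> W \<Longrightarrow> 0 \<le> amount w i"
  unfolding buyer_amount_def buyer_edges_def by (rule sum_nonneg) (auto simp: W_nonneg)

lemma amount_segment: "amount (\<lambda>e. w e + l * (w' e - w e)) i = amount w i + l * (amount w' i - amount w i)"
  by (simp add: buyer_amount_def sum.distrib sum_subtractf flip: sum_distrib_left)

lemma cost_segment: "cost (\<lambda>e. w e + l * (w' e - w e)) = cost w + l * (cost w' - cost w)"
  by (simp add: trade_cost_def sum.distrib sum_distrib_left sum_subtractf algebra_simps)

lemma amount_drop: "amount (\<lambda>e. if fst e = i then 0 else w e) k = (if k = i then 0 else amount w k)"
  unfolding buyer_amount_def buyer_edges_def by (auto intro!: sum.neutral sum.cong)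

lemma cost_drop:
  "cost (\<lambda>e. if fst e = i then 0 else w e) = cost w - (\<Sum>e\<in>buyer_edges E i. b (snd e) * w e)"
proof -
  have "cost w = (\<Sum>e\<in>buyer_edges E i. b (snd e) * w e) + (\<Sum>e\<in>E - buyer_edges E i. b (snd e) * w e)"
    unfolding trade_cost_def using finite_E
    by (subst sum.subset_diff[of "buyer_edges E i"]) (auto simp: buyer_edges_def)
  moreover have "cost (\<lambda>e. if fst e = i then 0 else w e) = (\<Sum>e\<in>E - buyer_edges E i. b (snd e) * w e)"
    unfolding trade_cost_def using finite_E
    by (intro sum.mono_neutral_cong_right) (auto simp: buyer_edges_def)
  ultimately show ?thesis by simp
qed

lemma continuous_on_amount: "continuous_on A (\<lambda>w. amount w i)"
  unfolding buyer_amount_def by (intro continuous_intros continuous_on_product_coordinates[THEN continuous_on_subset]) auto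

lemma continuous_on_surplus:
  assumes "X \<subseteq> N" "\<And>i. i \<in> X \<Longrightarrow> 0 < v i"
  shows "continuous_on W (surplus X E B b v)"
  unfolding surplus_def[abs_def] trade_cost_def
proof (intro continuous_intros)
  fix i assume i: "i \<in> X"
  show "continuous_on W (\<lambda>w. budget_value (v i) (B i) (amount w i))"
    using i assms amount_nonneg budget_nonneg
    by (intro continuous_on_compose2[OF continuous_on_budget_value continuous_on_amount]) auto
qed (intro continuous_on_product_coordinates[THEN continuous_on_subset], auto)

lemma surplus_bdd_above:
  assumes "X \<subseteq> N" "\<And>i. i \<in> X \<Longrightarrow> 0 < v i"
  shows "bdd_above (surplus X E B b v ` W)"
  using compact_continuous_image[OF continuous_on_surplus[OF assms] W_compact]
  by (simp add: bounded_imp_bdd_above compact_imp_bounded)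

lemma surplus_tangent:
  assumes "X \<subseteq> N" "\<And>i. i \<in> X \<Longrightarrow> 0 < v i" "w \<in> W" "w' \<in> W"
  shows "surplus X E B b v w' \<le> surplus X E B b v w
    + (\<Sum>i\<in>X. budget_slope (v i) (B i) (amount w i) * (amount w' i - amount w i))
    - (cost w' - cost w)"
proof -
  have "(\<Sum>i\<in>X. budget_value (v i) (B i) (amount w' i)) \<le>
    (\<Sum>i\<in>X. budget_value (v i) (B i) (amount w i)
      + budget_slope (v i) (B i) (amount w i) * (amount w' i - amount w i))"
    using assms by (intro sum_mono budget_value_tangent) (auto simp: amount_nonneg budget_nonneg)
  then show ?thesis by (simp add: surplus_def sum.distrib)
qed

text \<open>The tangent inequality taken at points of the segment from a surplus maximiser to \<open>w'\<close>, as these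
  points tend to the maximiser, gives the first-order condition without differentiating.\<close>
lemma clearing_exists:
  assumes v: "\<And>i. i \<in> N \<Longrightarrow> 0 < v i"
  shows "\<exists>w. clearing N E B b W v w"
proof -
  obtain w where w: "w \<in> W" and mx: "\<And>w'. w' \<in> W \<Longrightarrow> surplus N E B b v w' \<le> surplus N E B b v w"
    using continuous_attains_sup[OF W_compact W_nonempty continuous_on_surplus[of N v]] v by blast
  have "(\<Sum>i\<in>N. budget_slope (v i) (B i) (amount w i) * (amount w' i - amount w i)) \<le> cost w' - cost w"
    if w': "w' \<in> W" for w'
  proof -
    define z where "z l = (\<lambda>e. w e + l * (w' e - w e))" for l :: real
    define g where "g l = (\<Sum>i\<in>N. budget_slope (v i) (B i) (amount w i + l * (amount w' i - amount w i))
        * (amount w' i - amount w i))" for l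
    have ineq: "g l \<le> cost w' - cost w" if l: "0 < l" "l \<le> 1" for l
    proof -
      have zW: "z l \<in> W" unfolding z_def using l w w' by (intro W_convex) auto
      have "surplus N E B b v w \<le> surplus N E B b v (z l)
         + (\<Sum>i\<in>N. budget_slope (v i) (B i) (amount (z l) i) * (amount w i - amount (z l) i))
         - (cost w - cost (z l))"
        using surplus_tangent[OF order_refl v zW w] by simp
      moreover have "(\<Sum>i\<in>N. budget_slope (v i) (B i) (amount (z l) i) * (amount w i - amount (z l) i)) = - l * g l"
        unfolding z_def amount_segment g_def sum_distrib_left
        by (intro sum.cong) (auto simp: algebra_simps)
      moreover have "cost w - cost (z l) = - l * (cost w' - cost w)"
        unfolding z_def cost_segment by simp
      ultimately have "l * g l \<le> l * (cost w' - cost w)"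
        using mx[OF zW] by simp
      then show ?thesis using l by simp
    qed
    have "continuous_on UNIV g"
      unfolding g_def using v budget_nonneg
      by (intro continuous_intros continuous_on_compose2[OF continuous_on_budget_slope]) auto
    then have "(g \<longlongrightarrow> g 0) (at_right 0)"
      by (simp add: continuous_on_eq_continuous_at isCont_def filterlim_at_split)
    moreover have "eventually (\<lambda>l. g l \<le> cost w' - cost w) (at_right 0)"
      using eventually_at_right_real[of 0 1] by (rule eventually_mono) (auto intro: ineq)
    ultimately have "g 0 \<le> cost w' - cost w"
      by (intro tendsto_upperbound) auto
    then show ?thesis by (simp add: g_def)
  qed
  then show ?thesis using w by (auto simp: clearing_def)
qed

context
  fixes v w
  assumes v: "\<And>i. i \<in> N \<Longrightarrow> 0 < v i" and cl: "clearing N E B b W v w"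
begin

lemma clearing_in_W: "w \<in> W"
  using cl by (simp add: clearing_def)

lemma clearing_le:
  "w' \<in> W \<Longrightarrow> (\<Sum>i\<in>N. budget_slope (v i) (B i) (amount w i) * (amount w' i - amount w i))
     \<le> cost w' - cost w"
  using cl by (simp add: clearing_def)

lemma others_surplus_le:
  assumes w': "w' \<in> W" and i: "i \<in> N"
  shows "surplus (N - {i}) E B b v w' \<le> surplus (N - {i}) E B b v w
    + budget_slope (v i) (B i) (amount w i) * (amount w i - amount w' i)"
proof -
  have "(\<Sum>k\<in>N. budget_slope (v k) (B k) (amount w k) * (amount w' k - amount w k)) =
    budget_slope (v i) (B i) (amount w i) * (amount w' i - amount w i) +
    (\<Sum>k\<in>N-{i}. budget_slope (v k) (B k) (amount w k) * (amount w' k - amount w k))"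
    using finite_N i by (simp add: sum.remove)
  then show ?thesis
    using surplus_tangent[of "N - {i}" v w w'] v clearing_in_W w' clearing_le[OF w']
    by (simp add: algebra_simps)
qed

lemma externality_le:
  assumes i: "i \<in> N"
  shows "externality N E B b W v w i \<le> min (v i * amount w i) (B i)"
proof -
  let ?s = "budget_slope (v i) (B i) (amount w i)"
  have "(SUP w'\<in>W. surplus (N - {i}) E B b v w') \<le> surplus (N - {i}) E B b v w + ?s * amount w i"
  proof (rule cSUP_least[OF W_nonempty])
    fix w' assume w': "w' \<in> W"
    have "0 \<le> ?s * amount w' i"
      using i v w' clearing_in_W by (intro mult_nonneg_nonneg budget_slope_nonneg amount_nonneg budget_nonneg)
    then show "surplus (N - {i}) E B b v w' \<le> surplus (N - {i}) E B b v w + ?s * amount w i"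
      using others_surplus_le[OF w' i] by (simp add: algebra_simps)
  qed
  then show ?thesis
    using budget_slope_mult[OF v[OF i] budget_nonneg[OF i] amount_nonneg[OF clearing_in_W], of i]
    unfolding externality_def by linarith
qed

lemma externality_ge:
  assumes i: "i \<in> N"
  shows "(\<Sum>e\<in>buyer_edges E i. b (snd e) * w e) \<le> externality N E B b W v w i"
proof -
  let ?w = "\<lambda>e. if fst e = i then 0 else w e"
  have "surplus (N - {i}) E B b v ?w \<le> (SUP w'\<in>W. surplus (N - {i}) E B b v w')"
    using v by (intro cSUP_upper W_drop clearing_in_W surplus_bdd_above) auto
  moreover have "surplus (N - {i}) E B b v ?w =
      surplus (N - {i}) E B b v w + (\<Sum>e\<in>buyer_edges E i. b (snd e) * w e)"
    by (simp add: surplus_def cost_drop amount_drop)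
  ultimately show ?thesis by (simp add: externality_def)
qed

lemma zero_budget_amount:
  assumes i: "i \<in> N" and B0: "B i = 0"
  shows "amount w i = 0"
proof -
  have ext: "externality N E B b W v w i \<le> 0"
    using externality_le[OF i] B0 by simp
  have nn: "\<And>e. e \<in> buyer_edges E i \<Longrightarrow> 0 \<le> b (snd e) * w e"
    using W_nonneg[OF clearing_in_W] price_pos
    by (intro mult_nonneg_nonneg) (auto simp: buyer_edges_def intro: less_imp_le)
  have "(\<Sum>e\<in>buyer_edges E i. b (snd e) * w e) = 0"
    using ext externality_ge[OF i] sum_nonneg[OF nn] by (intro antisym) auto
  then have "\<forall>e\<in>buyer_edges E i. b (snd e) * w e = 0"
    using nn finite_E by (subst (asm) sum_nonneg_eq_0_iff) (auto simp: buyer_edges_def)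
  then have "\<forall>e\<in>buyer_edges E i. w e = 0"
    using price_pos by (fastforce simp: buyer_edges_def)
  then show ?thesis by (simp add: buyer_amount_def)
qed

lemma clearing_liquid_welfare:
  assumes y: "y \<in> W"
  shows "(\<Sum>i\<in>N. min (v i * amount y i) (B i)) - cost y
    \<le> 2 * (\<Sum>i\<in>N. min (v i * amount w i) (B i)) - cost w"
proof -
  let ?s = "\<lambda>i. budget_slope (v i) (B i) (amount w i)"
  have "(\<Sum>i\<in>N. min (v i * amount y i) (B i)) \<le> (\<Sum>i\<in>N. ?s i * amount y i + min (v i * amount w i) (B i))"
    using v y clearing_in_W by (intro sum_mono capped_value_le_twice) (auto simp: budget_nonneg amount_nonneg)
  moreover have "(\<Sum>i\<in>N. ?s i * amount w i) = (\<Sum>i\<in>N. min (v i * amount w i) (B i))"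
    using v clearing_in_W by (intro sum.cong budget_slope_mult) (auto simp: budget_nonneg amount_nonneg)
  ultimately show ?thesis
    using clearing_le[OF y] by (simp add: algebra_simps sum.distrib sum_subtractf)
qed

lemma clearing_social_welfare:
  assumes y: "y \<in> W"
  shows "(\<Sum>i\<in>N. min (v i * amount y i) (B i)) - cost y
    \<le> (\<Sum>i\<in>N. v i * amount w i) - cost w"
proof -
  let ?s = "\<lambda>i. budget_slope (v i) (B i) (amount w i)"
  have "(\<Sum>i\<in>N. min (v i * amount y i) (B i)) \<le> (\<Sum>i\<in>N. ?s i * amount y i + (v i - ?s i) * amount w i)"
    using v y clearing_in_W by (intro sum_mono capped_value_le_linear) (auto simp: budget_nonneg amount_nonneg)
  then show ?thesis
    using clearing_le[OF y] by (simp add: algebra_simps sum.distrib sum_subtractf)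
qed

end

text \<open>If the budget of \<open>i\<close> binds at \<open>w\<close> and the bid \<open>d\<close> gave her more, the two first-order conditions
  would contradict the strict decrease of \<open>B\<^sub>i/x\<close>. Zero budgets need positive prices.\<close>
lemma clearing_truthful:
  assumes v: "\<And>i. i \<in> N \<Longrightarrow> 0 < v i" and cl: "clearing N E B b W v w"
    and i: "i \<in> N" and d: "0 < d" and cl': "clearing N E B b W (v(i := d)) w'"
  shows "v i * amount w' i - externality N E B b W (v(i := d)) w' i
    \<le> v i * amount w i - externality N E B b W v w i"
proof -
  let ?s = "budget_slope (v i) (B i) (amount w i)"
  let ?s' = "budget_slope d (B i) (amount w' i)"
  let ?H = "surplus (N - {i}) E B b v"
  have v': "\<And>k. k \<in> N \<Longrightarrow> 0 < (v(i := d)) k" using v d by simp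
  have H': "surplus (N - {i}) E B b (v(i := d)) u = ?H u" for u
    by (auto simp: surplus_def intro!: sum.cong)
  note wW = clearing_in_W[OF v cl] and wW' = clearing_in_W[OF v' cl']
  have 1: "?H w' \<le> ?H w + ?s * (amount w i - amount w' i)"
    using others_surplus_le[OF v cl wW' i] .
  have 2: "?H w \<le> ?H w' + ?s' * (amount w' i - amount w i)"
    using others_surplus_le[OF v' cl' wW i] by (simp add: H')
  have le: "?s \<le> v i"
    using v i wW by (intro budget_slope_le budget_nonneg amount_nonneg) auto
  have "?s = v i \<or> amount w' i \<le> amount w i"
  proof (rule ccontr)
    assume n: "\<not> ?thesis"
    show False
    proof (cases "B i = 0")
      case True
      then show False
        using n zero_budget_amount[OF v cl i] zero_budget_amount[OF v' cl' i] by simp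
    next
      case False
      then have "?s' < ?s"
        using n le d v i wW budget_nonneg[OF i]
        by (intro budget_slope_strict_antimono) (auto simp: amount_nonneg)
      then have "0 < (?s - ?s') * (amount w' i - amount w i)"
        using n by (intro mult_pos_pos) auto
      then show False using 1 2 by (simp add: algebra_simps)
    qed
  qed
  then have "0 \<le> (v i - ?s) * (amount w i - amount w' i)"
    using le by auto
  then show ?thesis using 1 by (simp add: externality_def H' algebra_simps)
qed

end

section \<open>The mechanism\<close>

definition trades ::
  "'s set \<Rightarrow> ('b \<times> 's) set \<Rightarrow> ('s \<Rightarrow> ('b \<times> 's) set \<Rightarrow> real) \<Rightarrow> 's set \<Rightarrow> ('b \<times> 's \<Rightarrow> real) set" where
  "trades M E f S = {w. in_P M E f w \<and> (\<forall>e. snd e \<notin> S \<longrightarrow> w e = 0)}"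

definition gain ::
  "'b set \<Rightarrow> 's set \<Rightarrow> ('b \<times> 's) set \<Rightarrow> ('s \<Rightarrow> ('b \<times> 's) set \<Rightarrow> real) \<Rightarrow> ('b \<Rightarrow> real)
     \<Rightarrow> ('b \<Rightarrow> real) \<Rightarrow> 's set \<Rightarrow> ('s \<Rightarrow> real) \<Rightarrow> real" where
  "gain N M E f B v S b = (SUP w\<in>trades M E f S.
     (\<Sum>i\<in>N. min (v i * buyer_amount E w i) (B i)) - trade_cost E b w)"

definition endowment ::
  "'s set \<Rightarrow> ('b \<times> 's) set \<Rightarrow> ('s \<Rightarrow> ('b \<times> 's) set \<Rightarrow> real) \<Rightarrow> ('s \<Rightarrow> real) \<Rightarrow> real" where
  "endowment M E f \<rho> = (\<Sum>j\<in>M. \<rho> j * f j (seller_edges E j))"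

definition accepting :: "'s set \<Rightarrow> ('s \<Rightarrow> real) \<Rightarrow> ('s \<Rightarrow> real) \<Rightarrow> 's set" where
  "accepting M \<rho> \<rho>s = {j \<in> M. \<rho> j \<le> \<rho>s j}"

definition clearing_mech :: "('b, 's) mechanism" where
  "clearing_mech N M E f B v \<rho> \<rho>s =
     (let W = trades M E f (accepting M \<rho> \<rho>s);
          w = (SOME w. clearing N E B \<rho>s W v w)
      in (w, externality N E B \<rho>s W v w, \<lambda>j. \<rho>s j * sum w (seller_edges E j)))"

lemma compact_box: "compact {w :: 'a \<Rightarrow> real. \<forall>e. w e \<in> {0..u e}}"
proof -
  have "compactin (product_topology (\<lambda>i. euclidean) UNIV) (PiE UNIV (\<lambda>e. {0..u e}))"
    by (simp add: compactin_PiE)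
  then show ?thesis
    by (simp add: euclidean_product_topology PiE_UNIV_domain Pi_def)
qed

locale market =
  fixes N :: "'b set" and M :: "'s set" and E :: "('b \<times> 's) set"
    and f :: "'s \<Rightarrow> ('b \<times> 's) set \<Rightarrow> real" and B :: "'b \<Rightarrow> real"
  assumes valid: "valid_market N M E f" and budget: "i \<in> N \<Longrightarrow> 0 \<le> B i"
begin

lemma finite_N: "finite N" and finite_M: "finite M" and E_sub: "E \<subseteq> N \<times> M" and finite_E: "finite E"
  using valid by (auto simp: valid_market_def intro: finite_subset)

lemma f_nonneg: "j \<in> M \<Longrightarrow> F \<subseteq> seller_edges E j \<Longrightarrow> 0 \<le> f j F"
  using valid by (auto simp: valid_market_def polymatroid_fn_def)

lemma in_P_outside: "in_P M E f w \<Longrightarrow> e \<notin> E \<Longrightarrow> w e = 0"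
  unfolding in_P_def by blast

lemma in_P_antimono:
  assumes w: "in_P M E f w" and w': "\<And>e. 0 \<le> w' e" "\<And>e. w' e \<le> w e"
  shows "in_P M E f w'"
  unfolding in_P_def
proof (intro conjI ballI allI impI)
  fix j F assume F: "j \<in> M" "F \<subseteq> seller_edges E j"
  have "sum w' F \<le> sum w F" using w' by (intro sum_mono)
  also have "\<dots> \<le> f j F" using w F by (simp add: in_P_def)
  finally show "sum w' F \<le> f j F" .
next
  fix e assume "e \<notin> E"
  then show "w' e = 0" using in_P_outside[OF w] w'[of e] by simp
qed (rule w')

lemma in_P_nonneg: "in_P M E f w \<Longrightarrow> 0 \<le> w e"
  using in_P_outside[of w e] by (cases "e \<in> E") (auto simp: in_P_def)

lemma in_P_le:
  assumes w: "in_P M E f w" and e: "e \<in> E"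
  shows "w e \<le> f (snd e) {e}"
proof -
  have "snd e \<in> M" "{e} \<subseteq> seller_edges E (snd e)"
    using e E_sub by (auto simp: seller_edges_def)
  then have "sum w {e} \<le> f (snd e) {e}" using w unfolding in_P_def by blast
  then show ?thesis by simp
qed

lemma trades_filter:
  assumes w: "w \<in> trades M E f S" and T: "\<And>e. Q e \<Longrightarrow> snd e \<in> S \<Longrightarrow> snd e \<in> T"
  shows "(\<lambda>e. if Q e then w e else 0) \<in> trades M E f T"
proof -
  have P: "in_P M E f w" using w by (simp add: trades_def)
  have "in_P M E f (\<lambda>e. if Q e then w e else 0)"
    by (rule in_P_antimono[OF P]) (simp_all add: in_P_nonneg[OF P])
  moreover have "w e = 0" if "Q e" "snd e \<notin> T" for e
    using that w T[of e] by (auto simp: trades_def simp del: split_paired_All)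
  ultimately show ?thesis by (simp add: trades_def del: split_paired_All)
qed

lemma zero_trade: "(\<lambda>_. 0) \<in> trades M E f S"
  using f_nonneg by (auto simp: trades_def in_P_def)

lemma compact_trades: "compact (trades M E f S)"
proof -
  let ?u = "\<lambda>e. if e \<in> E then f (snd e) {e} else 0"
  let ?C = "(\<Inter>e\<in>E. {w. 0 \<le> w e}) \<inter> (\<Inter>e\<in>{e. e \<notin> E \<or> snd e \<notin> S}. {w. w e = 0})
    \<inter> (\<Inter>j\<in>M. \<Inter>F\<in>Pow (seller_edges E j). {w. sum w F \<le> f j F})"
  have cont: "continuous_on UNIV (\<lambda>w :: 'b \<times> 's \<Rightarrow> real. w e)" for e
    by (rule continuous_on_product_coordinates)
  have closed: "closed ?C"
    by (intro closed_Int closed_INT ballI closed_Collect_le closed_Collect_eq continuous_intros cont)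
  have eq: "trades M E f S = {w. \<forall>e. w e \<in> {0..?u e}} \<inter> ?C"
  proof (intro equalityI subsetI)
    fix w assume w: "w \<in> trades M E f S"
    then have "in_P M E f w" by (simp add: trades_def)
    then have "0 \<le> w e \<and> w e \<le> ?u e" for e
      using in_P_nonneg[of w e] in_P_le[of w e] in_P_outside[of w e] by simp
    then show "w \<in> {w. \<forall>e. w e \<in> {0..?u e}} \<inter> ?C"
      using w by (auto simp: trades_def in_P_def)
  qed (auto simp: trades_def in_P_def)
  show ?thesis unfolding eq by (rule compact_Int_closed[OF compact_box closed])
qed

lemma trades_segment:
  assumes w: "w \<in> trades M E f S" and w': "w' \<in> trades M E f S" and l: "0 \<le> l" "l \<le> 1"
  shows "(\<lambda>e. w e + l * (w' e - w e)) \<in> trades M E f S"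
proof -
  have eq: "w e + l * (w' e - w e) = (1 - l) * w e + l * w' e" for e
    by (simp add: algebra_simps)
  have "(\<Sum>e\<in>F. (1 - l) * w e + l * w' e) \<le> f j F" if "j \<in> M" "F \<subseteq> seller_edges E j" for j F
  proof -
    have "(\<Sum>e\<in>F. (1 - l) * w e + l * w' e) = (1 - l) * sum w F + l * sum w' F"
      by (simp add: sum.distrib sum_distrib_left)
    also have "\<dots> \<le> f j F"
      using w w' that l by (intro convex_bound_le) (auto simp: trades_def in_P_def)
    finally show ?thesis .
  qed
  then show ?thesis
    using w w' l unfolding eq by (auto simp: trades_def in_P_def)
qed

lemma auction:
  assumes "\<And>j. j \<in> M \<Longrightarrow> 0 < b j"
  shows "auction N E (trades M E f S) B b"
proof
  fix w i assume "w \<in> trades M E f S"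
  then have "(\<lambda>e. if fst e \<noteq> i then w e else 0) \<in> trades M E f S" by (rule trades_filter)
  moreover have "(\<lambda>e. if fst e \<noteq> i then w e else 0) = (\<lambda>e. if fst e = i then 0 else w e)" by auto
  ultimately show "(\<lambda>e. if fst e = i then 0 else w e) \<in> trades M E f S" by simp
next
  show "fst ` E \<subseteq> N" using E_sub by auto
  show "trades M E f S \<noteq> {}" using zero_trade by blast
  show "0 < b (snd e)" if "e \<in> E" for e using that E_sub assms by auto
  show "0 \<le> w e" if "w \<in> trades M E f S" for w e using that in_P_nonneg by (auto simp: trades_def)
qed (auto simp: finite_N finite_E budget compact_trades trades_segment)

lemma trade_cost_sellers: "trade_cost E b w = (\<Sum>j\<in>M. b j * sum w (seller_edges E j))"
proof -
  have "trade_cost E b w = (\<Sum>j\<in>M. \<Sum>e\<in>seller_edges E j. b (snd e) * w e)"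
    unfolding trade_cost_def seller_edges_def
    using E_sub finite_E finite_M by (intro sum.group[symmetric]) auto
  then show ?thesis by (simp add: sum_distrib_left seller_edges_def)
qed

lemma trade_cost_buyers: "trade_cost E b w = (\<Sum>i\<in>N. \<Sum>e\<in>buyer_edges E i. b (snd e) * w e)"
  unfolding trade_cost_def buyer_edges_def
  using E_sub finite_E finite_N by (intro sum.group[symmetric]) auto

lemma sellers_welfare:
  "(\<Sum>j\<in>M. \<rho> j * seller_amount E f w j) = endowment M E f \<rho> - trade_cost E \<rho> w"
  by (simp add: trade_cost_sellers endowment_def seller_amount_def right_diff_distrib sum_subtractf)

lemma trade_cost_le_endowment:
  assumes "in_P M E f w" "\<And>j. j \<in> M \<Longrightarrow> 0 \<le> \<rho> j"
  shows "trade_cost E \<rho> w \<le> endowment M E f \<rho>"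
  unfolding trade_cost_sellers endowment_def
  using assms by (intro sum_mono mult_left_mono) (auto simp: in_P_def)

lemma trade_cost_nonneg:
  assumes "in_P M E f w" "\<And>j. j \<in> M \<Longrightarrow> 0 \<le> \<rho> j"
  shows "0 \<le> trade_cost E \<rho> w"
  unfolding trade_cost_def
  using assms E_sub in_P_nonneg by (intro sum_nonneg mult_nonneg_nonneg) auto

lemma endowment_nonneg: "(\<And>j. j \<in> M \<Longrightarrow> 0 \<le> \<rho> j) \<Longrightarrow> 0 \<le> endowment M E f \<rho>"
  unfolding endowment_def by (intro sum_nonneg mult_nonneg_nonneg f_nonneg) auto

lemma bdd_above_gain:
  "bdd_above ((\<lambda>w. (\<Sum>i\<in>N. min (v i * buyer_amount E w i) (B i)) - trade_cost E b w) ` trades M E f S)"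
proof (rule bdd_aboveI2)
  fix w assume "w \<in> trades M E f S"
  then have w: "in_P M E f w" by (simp add: trades_def)
  have "(\<Sum>i\<in>N. min (v i * buyer_amount E w i) (B i)) \<le> (\<Sum>i\<in>N. B i)"
    by (intro sum_mono) simp
  moreover have "- trade_cost E b w \<le> (\<Sum>e\<in>E. \<bar>b (snd e)\<bar> * f (snd e) {e})"
    unfolding trade_cost_def sum_negf[symmetric]
  proof (rule sum_mono)
    fix e assume e: "e \<in> E"
    have "- (b (snd e) * w e) \<le> \<bar>b (snd e)\<bar> * w e"
      using in_P_nonneg[OF w, of e] by (metis abs_ge_minus_self mult_minus_left mult_right_mono)
    also have "\<dots> \<le> \<bar>b (snd e)\<bar> * f (snd e) {e}"
      using in_P_le[OF w e] by (intro mult_left_mono) auto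
    finally show "- (b (snd e) * w e) \<le> \<bar>b (snd e)\<bar> * f (snd e) {e}" .
  qed
  ultimately show "(\<Sum>i\<in>N. min (v i * buyer_amount E w i) (B i)) - trade_cost E b w
     \<le> (\<Sum>i\<in>N. B i) + (\<Sum>e\<in>E. \<bar>b (snd e)\<bar> * f (snd e) {e})"
    by simp
qed

lemma gain_upper:
  "w \<in> trades M E f S \<Longrightarrow>
   (\<Sum>i\<in>N. min (v i * buyer_amount E w i) (B i)) - trade_cost E b w \<le> gain N M E f B v S b"
  unfolding gain_def by (rule cSUP_upper[OF _ bdd_above_gain])

lemma gain_least:
  "(\<And>w. w \<in> trades M E f S \<Longrightarrow>
     (\<Sum>i\<in>N. min (v i * buyer_amount E w i) (B i)) - trade_cost E b w \<le> c)
   \<Longrightarrow> gain N M E f B v S b \<le> c"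
  unfolding gain_def using zero_trade by (intro cSUP_least) auto

lemma gain_nonneg: "0 \<le> gain N M E f B v S b"
proof -
  have "0 \<le> (\<Sum>i\<in>N. min (v i * buyer_amount E (\<lambda>_. 0) i) (B i)) - trade_cost E b (\<lambda>_. 0)"
    by (auto simp: buyer_amount_def trade_cost_def budget intro!: sum_nonneg)
  then show ?thesis using gain_upper[OF zero_trade] by (rule order_trans)
qed

lemma gain_lipschitz:
  "gain N M E f B v S b \<le> gain N M E f B v S b' + (\<Sum>e\<in>E. \<bar>b (snd e) - b' (snd e)\<bar> * f (snd e) {e})"
proof (rule gain_least)
  fix w assume wS: "w \<in> trades M E f S"
  then have w: "in_P M E f w" by (simp add: trades_def)
  have "trade_cost E b' w - trade_cost E b w \<le> (\<Sum>e\<in>E. \<bar>b (snd e) - b' (snd e)\<bar> * f (snd e) {e})"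
    unfolding trade_cost_def sum_subtractf[symmetric]
  proof (rule sum_mono)
    fix e assume e: "e \<in> E"
    have "b' (snd e) * w e - b (snd e) * w e = (b' (snd e) - b (snd e)) * w e"
      by (simp add: algebra_simps)
    also have "\<dots> \<le> \<bar>b (snd e) - b' (snd e)\<bar> * w e"
      using in_P_nonneg[OF w, of e] by (intro mult_right_mono) auto
    also have "\<dots> \<le> \<bar>b (snd e) - b' (snd e)\<bar> * f (snd e) {e}"
      using in_P_le[OF w e] by (intro mult_left_mono) auto
    finally show "b' (snd e) * w e - b (snd e) * w e \<le> \<bar>b (snd e) - b' (snd e)\<bar> * f (snd e) {e}" .
  qed
  then show "(\<Sum>i\<in>N. min (v i * buyer_amount E w i) (B i)) - trade_cost E b w
    \<le> gain N M E f B v S b' + (\<Sum>e\<in>E. \<bar>b (snd e) - b' (snd e)\<bar> * f (snd e) {e})"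
    using gain_upper[OF wS, of v b'] by linarith
qed

lemma LW_OPT_le: "LW_OPT N M E f B v \<rho> \<le> endowment M E f \<rho> + gain N M E f B v M \<rho>"
  unfolding LW_OPT_def
proof (rule cSUP_least)
  show "{w. in_P M E f w} \<noteq> {}" using zero_trade by (auto simp: trades_def)
next
  fix w assume "w \<in> {w. in_P M E f w}"
  then have "w \<in> trades M E f M" using E_sub by (auto simp: trades_def in_P_def)
  from gain_upper[OF this, of v \<rho>]
  show "liquid_welfare N M E f B v \<rho> w \<le> endowment M E f \<rho> + gain N M E f B v M \<rho>"
    by (simp add: liquid_welfare_def sellers_welfare)
qed

lemma optimum_split:
  assumes v: "\<And>i. i \<in> N \<Longrightarrow> 0 < v i"
    and \<rho>: "\<And>j. j \<in> M \<Longrightarrow> 0 \<le> \<rho> j" and \<rho>s: "\<And>j. j \<in> M \<Longrightarrow> 0 \<le> \<rho>s j"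
  shows "endowment M E f \<rho> + gain N M E f B v M \<rho>
    \<le> (endowment M E f \<rho> + gain N M E f B v (accepting M \<rho> \<rho>s) \<rho>s)
     + (endowment M E f \<rho>s + gain N M E f B v (accepting M \<rho>s \<rho>) \<rho>)"
proof -
  let ?S = "accepting M \<rho> \<rho>s" and ?T = "accepting M \<rho>s \<rho>"
  have "gain N M E f B v M \<rho> \<le> gain N M E f B v ?S \<rho>s + endowment M E f \<rho>s + gain N M E f B v ?T \<rho>"
  proof (rule gain_least)
    fix w assume w: "w \<in> trades M E f M"
    define w1 where "w1 = (\<lambda>e. if snd e \<in> ?S then w e else 0)"
    define w2 where "w2 = (\<lambda>e. if snd e \<notin> ?S then w e else 0)"
    have w1: "w1 \<in> trades M E f ?S" and w2: "w2 \<in> trades M E f ?T"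
      unfolding w1_def w2_def by (rule trades_filter[OF w]; auto simp: accepting_def)+
    have split: "w e = w1 e + w2 e" for e by (simp add: w1_def w2_def)
    have P: "in_P M E f w1" "in_P M E f w2" using w1 w2 by (simp_all add: trades_def)
    have nn: "0 \<le> buyer_amount E u i" if "in_P M E f u" for u i
      unfolding buyer_amount_def using in_P_nonneg[OF that] by (intro sum_nonneg)
    have "(\<Sum>i\<in>N. min (v i * buyer_amount E w i) (B i))
      \<le> (\<Sum>i\<in>N. min (v i * buyer_amount E w1 i) (B i) + min (v i * buyer_amount E w2 i) (B i))"
    proof (rule sum_mono)
      fix i assume i: "i \<in> N"
      have "buyer_amount E w i = buyer_amount E w1 i + buyer_amount E w2 i"
        unfolding buyer_amount_def by (simp add: split sum.distrib)
      moreover have "0 \<le> v i * buyer_amount E w1 i" "0 \<le> v i * buyer_amount E w2 i"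
        using v[OF i] nn[OF P(1)] nn[OF P(2)] by auto
      ultimately show "min (v i * buyer_amount E w i) (B i)
        \<le> min (v i * buyer_amount E w1 i) (B i) + min (v i * buyer_amount E w2 i) (B i)"
        using budget[OF i] by (auto simp: distrib_left min_def)
    qed
    moreover have "trade_cost E \<rho> w = trade_cost E \<rho> w1 + trade_cost E \<rho> w2"
      by (simp add: trade_cost_def split distrib_left sum.distrib)
    moreover have "trade_cost E \<rho>s w1 \<le> endowment M E f \<rho>s" "0 \<le> trade_cost E \<rho> w1"
      using trade_cost_le_endowment[OF P(1), of \<rho>s] trade_cost_nonneg[OF P(1), of \<rho>] \<rho> \<rho>s by auto
    moreover note gain_upper[OF w1, of v \<rho>s] gain_upper[OF w2, of v \<rho>]
    ultimately show "(\<Sum>i\<in>N. min (v i * buyer_amount E w i) (B i)) - trade_cost E \<rho> w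
      \<le> gain N M E f B v ?S \<rho>s + endowment M E f \<rho>s + gain N M E f B v ?T \<rho>"
      by (simp add: sum.distrib)
  qed
  then show ?thesis by simp
qed

context
  fixes v \<rho> \<rho>s w p r
  assumes v: "\<And>i. i \<in> N \<Longrightarrow> 0 < v i" and \<rho>: "\<And>j. j \<in> M \<Longrightarrow> 0 < \<rho> j"
    and \<rho>s: "\<And>j. j \<in> M \<Longrightarrow> 0 < \<rho>s j"
    and mech: "clearing_mech N M E f B v \<rho> \<rho>s = (w, p, r)"
begin

lemma mech_clearing: "clearing N E B \<rho>s (trades M E f (accepting M \<rho> \<rho>s)) v w"
  and mech_payment: "p = externality N E B \<rho>s (trades M E f (accepting M \<rho> \<rho>s)) v w"
  and mech_revenue: "r = (\<lambda>j. \<rho>s j * sum w (seller_edges E j))"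
proof -
  interpret A: auction N E "trades M E f (accepting M \<rho> \<rho>s)" B \<rho>s
    using \<rho>s by (rule auction)
  have w: "w = (SOME w. clearing N E B \<rho>s (trades M E f (accepting M \<rho> \<rho>s)) v w)"
    using mech by (simp add: clearing_mech_def Let_def)
  show cl: "clearing N E B \<rho>s (trades M E f (accepting M \<rho> \<rho>s)) v w"
    unfolding w using A.clearing_exists[of v] v by (metis someI_ex)
  show "p = externality N E B \<rho>s (trades M E f (accepting M \<rho> \<rho>s)) v w"
    "r = (\<lambda>j. \<rho>s j * sum w (seller_edges E j))"
    using mech w by (auto simp: clearing_mech_def Let_def)
qed

lemma mech_trades: "w \<in> trades M E f (accepting M \<rho> \<rho>s)"
  using mech_clearing by (simp add: clearing_def)

lemma mech_in_P: "in_P M E f w"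
  using mech_trades by (simp add: trades_def)

lemma mech_payment_le: "i \<in> N \<Longrightarrow> p i \<le> min (v i * buyer_amount E w i) (B i)"
  unfolding mech_payment
  by (rule auction.externality_le[OF auction[OF \<rho>s] v mech_clearing])

lemma mech_budget_balance: "(\<Sum>j\<in>M. r j) \<le> (\<Sum>i\<in>N. p i)"
proof -
  have "(\<Sum>j\<in>M. r j) = (\<Sum>i\<in>N. \<Sum>e\<in>buyer_edges E i. \<rho>s (snd e) * w e)"
    using trade_cost_sellers[of \<rho>s w] trade_cost_buyers[of \<rho>s w] by (simp add: mech_revenue)
  also have "\<dots> \<le> (\<Sum>i\<in>N. p i)"
    unfolding mech_payment
    by (intro sum_mono auction.externality_ge[OF auction[OF \<rho>s] v mech_clearing])
  finally show ?thesis .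
qed

lemma mech_rejecting_seller: "j \<in> M \<Longrightarrow> \<not> \<rho> j \<le> \<rho>s j \<Longrightarrow> sum w (seller_edges E j) = 0"
  using mech_trades by (intro sum.neutral) (auto simp: trades_def accepting_def seller_edges_def)

lemma mech_seller_amount_nonneg: "0 \<le> sum w (seller_edges E j)"
  using in_P_nonneg[OF mech_in_P] by (intro sum_nonneg)

lemma mech_trade_cost_le: "trade_cost E \<rho> w \<le> trade_cost E \<rho>s w"
  unfolding trade_cost_sellers
  using mech_rejecting_seller mech_seller_amount_nonneg
  by (intro sum_mono) (metis mult_right_mono mult_zero_right order_refl)

lemma mech_social_welfare:
  "endowment M E f \<rho> + gain N M E f B v (accepting M \<rho> \<rho>s) \<rho>s \<le> social_welfare N M E f v \<rho> w"
proof -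
  have "gain N M E f B v (accepting M \<rho> \<rho>s) \<rho>s \<le> (\<Sum>i\<in>N. v i * buyer_amount E w i) - trade_cost E \<rho>s w"
    by (rule gain_least) (rule auction.clearing_social_welfare[OF auction[OF \<rho>s] v mech_clearing])
  then show ?thesis
    using mech_trade_cost_le by (simp add: social_welfare_def sellers_welfare)
qed

lemma mech_liquid_welfare:
  "endowment M E f \<rho> + gain N M E f B v (accepting M \<rho> \<rho>s) \<rho>s \<le> 2 * liquid_welfare N M E f B v \<rho> w"
proof -
  have "gain N M E f B v (accepting M \<rho> \<rho>s) \<rho>s
    \<le> 2 * (\<Sum>i\<in>N. min (v i * buyer_amount E w i) (B i)) - trade_cost E \<rho>s w"
    by (rule gain_least) (rule auction.clearing_liquid_welfare[OF auction[OF \<rho>s] v mech_clearing])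
  moreover have "trade_cost E \<rho> w \<le> endowment M E f \<rho>"
    using mech_in_P \<rho> by (intro trade_cost_le_endowment) (auto intro: less_imp_le)
  ultimately show ?thesis
    using mech_trade_cost_le by (simp add: liquid_welfare_def sellers_welfare)
qed

end

end

lemma admissible_market: "admissible_input N M E f B v \<rho> \<rho>s \<Longrightarrow> market N M E f B"
  by (simp add: admissible_input_def market_def)

lemma clearing_mech_feasible: "is_mechanism clearing_mech"
  unfolding is_mechanism_def
proof (intro allI impI)
  fix N M E f B v \<rho> \<rho>s
  assume adm: "admissible_input N M E f B v \<rho> \<rho>s"
  interpret market N M E f B using adm by (rule admissible_market)
  obtain w p r where m: "clearing_mech N M E f B v \<rho> \<rho>s = (w, p, r)" by (metis prod_cases3)
  show "feasible_alloc N M E f B (clearing_mech N M E f B v \<rho> \<rho>s)"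
    using adm mech_in_P[OF _ _ _ m] mech_payment_le[OF _ _ _ m]
    by (auto simp: feasible_alloc_def m admissible_input_def)
qed

lemma clearing_mech_IR: "IR clearing_mech"
  unfolding IR_def
proof (intro allI impI conjI ballI)
  fix N M E f B v \<rho> \<rho>s
  assume adm: "admissible_input N M E f B v \<rho> \<rho>s"
  interpret market N M E f B using adm by (rule admissible_market)
  obtain w p r where m: "clearing_mech N M E f B v \<rho> \<rho>s = (w, p, r)" by (metis prod_cases3)
  show "0 \<le> buyer_utility E (v i) i (clearing_mech N M E f B v \<rho> \<rho>s)" if "i \<in> N" for i
    using adm that mech_payment_le[OF _ _ _ m]
    by (auto simp: buyer_utility_def m admissible_input_def)
  show "0 \<le> seller_utility E (\<rho> j) j (clearing_mech N M E f B v \<rho> \<rho>s)" if j: "j \<in> M" for j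
  proof (cases "\<rho> j \<le> \<rho>s j")
    case True
    then show ?thesis
      using adm mech_revenue[OF _ _ _ m] mech_seller_amount_nonneg[OF _ _ _ m, of j]
      by (simp add: seller_utility_def m admissible_input_def mult_right_mono)
  next
    case False
    then show ?thesis
      using adm mech_revenue[OF _ _ _ m] mech_rejecting_seller[OF _ _ _ m, of j] j
      by (simp add: seller_utility_def m admissible_input_def)
  qed
qed

lemma clearing_mech_WBB: "WBB clearing_mech"
  unfolding WBB_def
proof (intro allI impI)
  fix N M E f B v \<rho> \<rho>s
  assume adm: "admissible_input N M E f B v \<rho> \<rho>s"
  interpret market N M E f B using adm by (rule admissible_market)
  obtain w p r where m: "clearing_mech N M E f B v \<rho> \<rho>s = (w, p, r)" by (metis prod_cases3)
  show "case clearing_mech N M E f B v \<rho> \<rho>s of (w, p, r) \<Rightarrow> (\<Sum>j\<in>M. r j) \<le> (\<Sum>i\<in>N. p i)"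
    using adm mech_budget_balance[OF _ _ _ m] by (simp add: m admissible_input_def)
qed

lemma clearing_mech_DSIC: "DSIC clearing_mech"
  unfolding DSIC_def
proof (intro allI impI conjI ballI)
  fix N M E f B v \<rho> \<rho>s
  assume adm: "admissible_input N M E f B v \<rho> \<rho>s"
  interpret market N M E f B using adm by (rule admissible_market)
  have v: "\<And>i. i \<in> N \<Longrightarrow> 0 < v i" and \<rho>: "\<And>j. j \<in> M \<Longrightarrow> 0 < \<rho> j" and \<rho>s: "\<And>j. j \<in> M \<Longrightarrow> 0 < \<rho>s j"
    using adm by (auto simp: admissible_input_def)
  obtain w p r where m: "clearing_mech N M E f B v \<rho> \<rho>s = (w, p, r)" by (metis prod_cases3)
  show "buyer_utility E (v i) i (clearing_mech N M E f B (v(i := d)) \<rho> \<rho>s)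
      \<le> buyer_utility E (v i) i (clearing_mech N M E f B v \<rho> \<rho>s)" if i: "i \<in> N" and d: "0 < d" for i d
  proof -
    obtain w' p' r' where m': "clearing_mech N M E f B (v(i := d)) \<rho> \<rho>s = (w', p', r')"
      by (metis prod_cases3)
    have v': "\<And>k. k \<in> N \<Longrightarrow> 0 < (v(i := d)) k" using v d by simp
    show ?thesis
      using auction.clearing_truthful[OF auction[OF \<rho>s] v mech_clearing[OF v \<rho> \<rho>s m] i d
          mech_clearing[OF v' \<rho> \<rho>s m']]
      by (simp add: buyer_utility_def m m' mech_payment[OF v \<rho> \<rho>s m] mech_payment[OF v' \<rho> \<rho>s m'])
  qed
  show "seller_utility E (\<rho> j) j (clearing_mech N M E f B v (\<rho>(j := d)) \<rho>s)
      \<le> seller_utility E (\<rho> j) j (clearing_mech N M E f B v \<rho> \<rho>s)" if j: "j \<in> M" and d: "0 < d" for j d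
  proof -
    obtain w' p' r' where m': "clearing_mech N M E f B v (\<rho>(j := d)) \<rho>s = (w', p', r')"
      by (metis prod_cases3)
    have \<rho>': "\<And>k. k \<in> M \<Longrightarrow> 0 < (\<rho>(j := d)) k" using \<rho> d by simp
    note facts = mech_revenue[OF v \<rho> \<rho>s m] mech_revenue[OF v \<rho>' \<rho>s m']
      mech_seller_amount_nonneg[OF v \<rho> \<rho>s m, of j] mech_seller_amount_nonneg[OF v \<rho>' \<rho>s m', of j]
      mech_rejecting_seller[OF v \<rho> \<rho>s m j] mech_rejecting_seller[OF v \<rho>' \<rho>s m' j]
    show ?thesis
    proof (cases "d \<le> \<rho>s j \<longleftrightarrow> \<rho> j \<le> \<rho>s j")
      case True
      then have "accepting M (\<rho>(j := d)) \<rho>s = accepting M \<rho> \<rho>s"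
        by (auto simp: accepting_def)
      then show ?thesis by (simp add: clearing_mech_def)
    next
      case False
      then show ?thesis
        using facts by (cases "d \<le> \<rho>s j") (auto simp: seller_utility_def m m' mult_right_mono)
    qed
  qed
qed

section \<open>Expected welfare\<close>

lemma borel_measurable_coordinate:
  assumes "j \<in> M" "sets (G j) = sets borel"
  shows "(\<lambda>b. b j) \<in> borel_measurable (PiM M G)"
  using measurable_component_singleton[OF assms(1), of G] measurable_cong_sets[OF refl assms(2)] by blast

context market
begin

text \<open>Rounding the prices makes the gain a function of countably many values; by its Lipschitz
  dependence on the prices it is the limit of these roundings.\<close>
lemma borel_measurable_gain:
  assumes G: "\<And>j. j \<in> M \<Longrightarrow> sets (G j) = sets borel"
  shows "gain N M E f B v S \<in> borel_measurable (PiM M G)"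
proof -
  define q where "q n b = (\<lambda>j\<in>M. \<lceil>b j * real (Suc n)\<rceil>)" for n and b :: "'s \<Rightarrow> real"
  define h where "h n c = gain N M E f B v S (\<lambda>j. real_of_int (c j) / real (Suc n))"
    for n and c :: "'s \<Rightarrow> int"
  define K where "K = (\<Sum>e\<in>E. f (snd e) {e})"
  have "(\<lambda>b. h n (q n b)) \<in> borel_measurable (PiM M G)" for n
  proof -
    have comp: "(\<lambda>b. b j) \<in> borel_measurable (PiM M G)" if "j \<in> M" for j
      using that G by (intro borel_measurable_coordinate)
    have "q n \<in> measurable (PiM M G) (PiM M (\<lambda>_. count_space UNIV))"
      unfolding q_def
      by (rule measurable_restrict) (use comp in measurable)
    also have "PiM M (\<lambda>_. count_space (UNIV :: int set)) = count_space (PiE M (\<lambda>_. UNIV))"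
      using finite_M by (intro count_space_PiM_finite) auto
    finally show ?thesis
      by (rule measurable_compose) (simp add: measurable_count_space_eq1)
  qed
  moreover have "(\<lambda>n. h n (q n b)) \<longlonglongrightarrow> gain N M E f B v S b" for b
  proof (rule Lim_null_comparison[THEN LIM_zero_cancel])
    show "eventually (\<lambda>n. norm (h n (q n b) - gain N M E f B v S b) \<le> K / real (Suc n)) sequentially"
    proof (intro always_eventually allI)
      fix n
      let ?b = "\<lambda>j. real_of_int (q n b j) / real (Suc n)"
      have "\<bar>?b (snd e) - b (snd e)\<bar> * f (snd e) {e} \<le> (1 / real (Suc n)) * f (snd e) {e}"
        if e: "e \<in> E" for e
      proof (rule mult_right_mono)
        have j: "snd e \<in> M" using e E_sub by auto
        then show "0 \<le> f (snd e) {e}" using e by (intro f_nonneg) (auto simp: seller_edges_def)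
        have "\<bar>real_of_int \<lceil>b (snd e) * real (Suc n)\<rceil> - b (snd e) * real (Suc n)\<bar> \<le> 1"
          by linarith
        then have "\<bar>real_of_int \<lceil>b (snd e) * real (Suc n)\<rceil> - b (snd e) * real (Suc n)\<bar> / real (Suc n)
            \<le> 1 / real (Suc n)"
          by (intro divide_right_mono) auto
        moreover have "?b (snd e) - b (snd e)
            = (real_of_int \<lceil>b (snd e) * real (Suc n)\<rceil> - b (snd e) * real (Suc n)) / real (Suc n)"
          using j by (simp add: q_def field_simps)
        ultimately show "\<bar>?b (snd e) - b (snd e)\<bar> \<le> 1 / real (Suc n)"
          by (simp add: abs_divide)
      qed
      then have "(\<Sum>e\<in>E. \<bar>?b (snd e) - b (snd e)\<bar> * f (snd e) {e}) \<le> K / real (Suc n)"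
        by (simp add: K_def sum_divide_distrib sum_mono)
      then show "norm (h n (q n b) - gain N M E f B v S b) \<le> K / real (Suc n)"
        using gain_lipschitz[of v S ?b b] gain_lipschitz[of v S b ?b]
        by (simp add: h_def abs_le_iff abs_minus_commute)
    qed
    show "(\<lambda>n. K / real (Suc n)) \<longlonglongrightarrow> 0"
      by (rule lim_const_over_n[THEN LIMSEQ_Suc])
  qed
  ultimately show ?thesis by (rule borel_measurable_LIMSEQ_real[rotated])
qed

lemma borel_measurable_endowment:
  assumes G: "\<And>j. j \<in> M \<Longrightarrow> sets (G j) = sets borel"
  shows "endowment M E f \<in> borel_measurable (PiM M G)"
  unfolding endowment_def[abs_def]
proof (intro borel_measurable_sum borel_measurable_times borel_measurable_const)
  fix j assume j: "j \<in> M"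
  show "(\<lambda>b. b j) \<in> borel_measurable (PiM M G)"
    using j G by (intro borel_measurable_coordinate)
qed

lemma borel_measurable_accepting_gain:
  assumes G: "\<And>j. j \<in> M \<Longrightarrow> sets (G j) = sets borel"
  shows "(\<lambda>z. gain N M E f B v (accepting M (fst z) (snd z)) (snd z))
    \<in> borel_measurable (PiM M G \<Otimes>\<^sub>M PiM M G)"
proof (rule measurable_compose_countable'[where I = "Pow M"])
  show "(\<lambda>z. gain N M E f B v S (snd z)) \<in> borel_measurable (PiM M G \<Otimes>\<^sub>M PiM M G)" for S
    by (rule measurable_compose[OF measurable_snd borel_measurable_gain[OF G]])
  show "countable (Pow M)" using finite_M by (simp add: countable_finite)
  show "(\<lambda>z. accepting M (fst z) (snd z))
    \<in> measurable (PiM M G \<Otimes>\<^sub>M PiM M G) (count_space (Pow M))"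
  proof (subst measurable_count_space_eq2)
    have comp: "(\<lambda>b. b j) \<in> borel_measurable (PiM M G)" if "j \<in> M" for j
      using that G by (intro borel_measurable_coordinate)
    have "(\<lambda>z. accepting M (fst z) (snd z)) -` {T} \<inter> space (PiM M G \<Otimes>\<^sub>M PiM M G)
      \<in> sets (PiM M G \<Otimes>\<^sub>M PiM M G)" if T: "T \<in> Pow M" for T
    proof -
      have "{z \<in> space (PiM M G \<Otimes>\<^sub>M PiM M G). \<forall>j\<in>M. j \<in> T \<longleftrightarrow> fst z j \<le> snd z j}
        \<in> sets (PiM M G \<Otimes>\<^sub>M PiM M G)"
      proof (rule sets.sets_Collect_finite_All[OF _ finite_M])
        fix j assume j: "j \<in> M"
        note [measurable] = measurable_compose[OF measurable_fst[of "PiM M G" "PiM M G"] comp[OF j]]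
          measurable_compose[OF measurable_snd[of "PiM M G" "PiM M G"] comp[OF j]]
        show "{z \<in> space (PiM M G \<Otimes>\<^sub>M PiM M G). j \<in> T \<longleftrightarrow> fst z j \<le> snd z j}
          \<in> sets (PiM M G \<Otimes>\<^sub>M PiM M G)"
          by measurable
      qed
      moreover have "(\<lambda>z. accepting M (fst z) (snd z)) -` {T} \<inter> space (PiM M G \<Otimes>\<^sub>M PiM M G)
        = {z \<in> space (PiM M G \<Otimes>\<^sub>M PiM M G). \<forall>j\<in>M. j \<in> T \<longleftrightarrow> fst z j \<le> snd z j}"
        using T by (auto simp: accepting_def)
      ultimately show ?thesis by simp
    qed
    then show "(\<lambda>z. accepting M (fst z) (snd z)) \<in> space (PiM M G \<Otimes>\<^sub>M PiM M G) \<rightarrow> Pow M \<and>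
      (\<forall>a\<in>Pow M. (\<lambda>z. accepting M (fst z) (snd z)) -` {a} \<inter> space (PiM M G \<Otimes>\<^sub>M PiM M G)
        \<in> sets (PiM M G \<Otimes>\<^sub>M PiM M G))"
      by (auto simp: accepting_def)
  qed (use finite_M in simp)
qed

context
  fixes v :: "'b \<Rightarrow> real" and G :: "'s \<Rightarrow> real measure"
  assumes v: "\<And>i. i \<in> N \<Longrightarrow> 0 < v i" and G: "\<And>j. j \<in> M \<Longrightarrow> positive_distribution (G j)"
begin

lemma AE_positive_profiles:
  "AE z in PiM M G \<Otimes>\<^sub>M PiM M G. (\<forall>j\<in>M. 0 < fst z j) \<and> (\<forall>j\<in>M. 0 < snd z j)"
proof -
  interpret P: prob_space "PiM M G"
    using G by (intro prob_space_PiM) (simp add: positive_distribution_def)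
  interpret PP: pair_prob_space "PiM M G" "PiM M G" ..
  have ae: "AE b in PiM M G. \<forall>j\<in>M. 0 < b j"
    using G finite_M by (intro AE_finite_allI AE_PiM_component) (auto simp: positive_distribution_def)
  have fst: "AE z in PiM M G \<Otimes>\<^sub>M PiM M G. \<forall>j\<in>M. 0 < fst z j"
    by (rule AE_distrD[OF measurable_fst]) (subst P.distr_pair_fst, rule ae)
  have "AE z in PiM M G \<Otimes>\<^sub>M PiM M G. \<forall>j\<in>M. 0 < snd z j"
  proof -
    have "AE z in distr (PiM M G \<Otimes>\<^sub>M PiM M G) (PiM M G \<Otimes>\<^sub>M PiM M G) (\<lambda>(x, y). (y, x)).
        \<forall>j\<in>M. 0 < fst z j"
      unfolding PP.distr_pair_swap[symmetric] by (rule fst)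
    from AE_distrD[OF measurable_pair_swap' this] show ?thesis by (simp add: case_prod_beta)
  qed
  with fst show ?thesis by eventually_elim simp
qed

lemma expected_optimum_le:
  "(\<integral>\<^sup>+ \<rho>. ennreal (LW_OPT N M E f B v \<rho>) \<partial>(PiM M G))
   \<le> 2 * (\<integral>\<^sup>+ z. ennreal (endowment M E f (fst z)
        + gain N M E f B v (accepting M (fst z) (snd z)) (snd z)) \<partial>(PiM M G \<Otimes>\<^sub>M PiM M G))"
proof -
  interpret P: prob_space "PiM M G"
    using G by (intro prob_space_PiM) (simp add: positive_distribution_def)
  interpret PP: pair_prob_space "PiM M G" "PiM M G" ..
  have sets: "\<And>j. j \<in> M \<Longrightarrow> sets (G j) = sets borel"
    using G by (simp add: positive_distribution_def)
  note [measurable] = borel_measurable_gain[OF sets, where v = v] borel_measurable_endowment[OF sets]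
    borel_measurable_accepting_gain[OF sets, where v = v]
  let ?U = "\<lambda>\<rho>. endowment M E f \<rho> + gain N M E f B v M \<rho>"
  let ?Q = "\<lambda>z. endowment M E f (fst z) + gain N M E f B v (accepting M (fst z) (snd z)) (snd z)"
  have "(\<integral>\<^sup>+ \<rho>. ennreal (LW_OPT N M E f B v \<rho>) \<partial>(PiM M G)) \<le> (\<integral>\<^sup>+ \<rho>. ennreal (?U \<rho>) \<partial>(PiM M G))"
    by (intro nn_integral_mono ennreal_leI LW_OPT_le)
  also have "\<dots> = (\<integral>\<^sup>+ z. ennreal (?U (fst z)) \<partial>(PiM M G \<Otimes>\<^sub>M PiM M G))"
    by (subst P.nn_integral_fst[symmetric]) (simp_all add: P.emeasure_space_1)
  also have "\<dots> \<le> (\<integral>\<^sup>+ z. ennreal (?Q z) + ennreal (?Q (snd z, fst z)) \<partial>(PiM M G \<Otimes>\<^sub>M PiM M G))"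
  proof (rule nn_integral_mono_AE, use AE_positive_profiles in eventually_elim)
    fix z :: "('s \<Rightarrow> real) \<times> ('s \<Rightarrow> real)"
    assume pos: "(\<forall>j\<in>M. 0 < fst z j) \<and> (\<forall>j\<in>M. 0 < snd z j)"
    have "0 \<le> ?Q z" "0 \<le> ?Q (snd z, fst z)"
      using pos by (auto intro!: add_nonneg_nonneg endowment_nonneg gain_nonneg intro: less_imp_le)
    moreover have "?U (fst z) \<le> ?Q z + ?Q (snd z, fst z)"
      using optimum_split[of v "fst z" "snd z"] pos v by (auto simp: less_imp_le)
    ultimately show "ennreal (?U (fst z)) \<le> ennreal (?Q z) + ennreal (?Q (snd z, fst z))"
      by (simp add: ennreal_leI flip: ennreal_plus)
  qed
  also have "\<dots> = (\<integral>\<^sup>+ z. ennreal (?Q z) \<partial>(PiM M G \<Otimes>\<^sub>M PiM M G))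
      + (\<integral>\<^sup>+ z. ennreal (?Q (snd z, fst z)) \<partial>(PiM M G \<Otimes>\<^sub>M PiM M G))"
  proof (rule nn_integral_add)
    have "?Q \<in> borel_measurable (PiM M G \<Otimes>\<^sub>M PiM M G)" by measurable
    then show "(\<lambda>z. ennreal (?Q z)) \<in> borel_measurable (PiM M G \<Otimes>\<^sub>M PiM M G)" by measurable
    show "(\<lambda>z. ennreal (?Q (snd z, fst z))) \<in> borel_measurable (PiM M G \<Otimes>\<^sub>M PiM M G)"
      by (rule measurable_compose[OF _ \<open>(\<lambda>z. ennreal (?Q z)) \<in> _\<close>]) measurable
  qed
  also have "(\<integral>\<^sup>+ z. ennreal (?Q (snd z, fst z)) \<partial>(PiM M G \<Otimes>\<^sub>M PiM M G))
      = (\<integral>\<^sup>+ z. ennreal (?Q z) \<partial>(PiM M G \<Otimes>\<^sub>M PiM M G))"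
    by (subst (2) PP.distr_pair_swap, subst nn_integral_distr) (auto simp: case_prod_beta)
  finally show ?thesis by (simp add: mult_2)
qed

lemma expected_liquid_welfare:
  "ennreal (1/4) * (\<integral>\<^sup>+ \<rho>. ennreal (LW_OPT N M E f B v \<rho>) \<partial>(PiM M G))
   \<le> (\<integral>\<^sup>+ z. ennreal (liquid_welfare N M E f B v (fst z)
        (fst (clearing_mech N M E f B v (fst z) (snd z)))) \<partial>(PiM M G \<Otimes>\<^sub>M PiM M G))"
proof -
  let ?Q = "\<lambda>z. endowment M E f (fst z) + gain N M E f B v (accepting M (fst z) (snd z)) (snd z)"
  have sets: "\<And>j. j \<in> M \<Longrightarrow> sets (G j) = sets borel"
    using G by (simp add: positive_distribution_def)
  note [measurable] = borel_measurable_endowment[OF sets] borel_measurable_accepting_gain[OF sets, where v = v]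
  have "ennreal (1/4) * (\<integral>\<^sup>+ \<rho>. ennreal (LW_OPT N M E f B v \<rho>) \<partial>(PiM M G))
    \<le> ennreal (1/4) * (2 * (\<integral>\<^sup>+ z. ennreal (?Q z) \<partial>(PiM M G \<Otimes>\<^sub>M PiM M G)))"
    by (intro mult_left_mono expected_optimum_le) simp
  also have "\<dots> = (ennreal (1/4) * ennreal 2) * (\<integral>\<^sup>+ z. ennreal (?Q z) \<partial>(PiM M G \<Otimes>\<^sub>M PiM M G))"
    by (simp add: mult.assoc)
  also have "ennreal (1/4) * ennreal 2 = ennreal (1/2)"
    by (subst ennreal_mult[symmetric]) auto
  also have "ennreal (1/2) * (\<integral>\<^sup>+ z. ennreal (?Q z) \<partial>(PiM M G \<Otimes>\<^sub>M PiM M G))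
    = (\<integral>\<^sup>+ z. ennreal (1/2) * ennreal (?Q z) \<partial>(PiM M G \<Otimes>\<^sub>M PiM M G))"
    by (rule nn_integral_cmult[symmetric]) measurable
  also have "\<dots> \<le> (\<integral>\<^sup>+ z. ennreal (liquid_welfare N M E f B v (fst z)
        (fst (clearing_mech N M E f B v (fst z) (snd z)))) \<partial>(PiM M G \<Otimes>\<^sub>M PiM M G))"
  proof (rule nn_integral_mono_AE, use AE_positive_profiles in eventually_elim)
    fix z :: "('s \<Rightarrow> real) \<times> ('s \<Rightarrow> real)"
    assume pos: "(\<forall>j\<in>M. 0 < fst z j) \<and> (\<forall>j\<in>M. 0 < snd z j)"
    obtain w p r where m: "clearing_mech N M E f B v (fst z) (snd z) = (w, p, r)"
      by (metis prod_cases3)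
    show "ennreal (1/2) * ennreal (?Q z) \<le> ennreal (liquid_welfare N M E f B v (fst z)
        (fst (clearing_mech N M E f B v (fst z) (snd z))))"
      using mech_liquid_welfare[OF _ _ _ m] v pos
      by (subst ennreal_mult'[symmetric]) (auto intro!: ennreal_leI simp: m)
  qed
  finally show ?thesis .
qed

lemma expected_social_welfare:
  "ennreal (1/2) * (\<integral>\<^sup>+ \<rho>. ennreal (LW_OPT N M E f B v \<rho>) \<partial>(PiM M G))
   \<le> (\<integral>\<^sup>+ z. ennreal (social_welfare N M E f v (fst z)
        (fst (clearing_mech N M E f B v (fst z) (snd z)))) \<partial>(PiM M G \<Otimes>\<^sub>M PiM M G))"
proof -
  let ?Q = "\<lambda>z. endowment M E f (fst z) + gain N M E f B v (accepting M (fst z) (snd z)) (snd z)"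
  have "ennreal (1/2) * (\<integral>\<^sup>+ \<rho>. ennreal (LW_OPT N M E f B v \<rho>) \<partial>(PiM M G))
    \<le> ennreal (1/2) * (ennreal 2 * (\<integral>\<^sup>+ z. ennreal (?Q z) \<partial>(PiM M G \<Otimes>\<^sub>M PiM M G)))"
    using expected_optimum_le by (intro mult_left_mono) simp_all
  also have "\<dots> = (ennreal (1/2) * ennreal 2) * (\<integral>\<^sup>+ z. ennreal (?Q z) \<partial>(PiM M G \<Otimes>\<^sub>M PiM M G))"
    by (simp only: mult.assoc)
  also have "ennreal (1/2) * ennreal 2 = 1"
    by (subst ennreal_mult[symmetric]) auto
  also have "1 * (\<integral>\<^sup>+ z. ennreal (?Q z) \<partial>(PiM M G \<Otimes>\<^sub>M PiM M G))
    \<le> (\<integral>\<^sup>+ z. ennreal (social_welfare N M E f v (fst z)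
        (fst (clearing_mech N M E f B v (fst z) (snd z)))) \<partial>(PiM M G \<Otimes>\<^sub>M PiM M G))"
    unfolding mult_1
  proof (rule nn_integral_mono_AE, use AE_positive_profiles in eventually_elim)
    fix z :: "('s \<Rightarrow> real) \<times> ('s \<Rightarrow> real)"
    assume pos: "(\<forall>j\<in>M. 0 < fst z j) \<and> (\<forall>j\<in>M. 0 < snd z j)"
    obtain w p r where m: "clearing_mech N M E f B v (fst z) (snd z) = (w, p, r)"
      by (metis prod_cases3)
    show "ennreal (?Q z) \<le> ennreal (social_welfare N M E f v (fst z)
        (fst (clearing_mech N M E f B v (fst z) (snd z))))"
      using mech_social_welfare[OF _ _ _ m] v pos by (auto intro!: ennreal_leI simp: m)
  qed
  finally show ?thesis .
qed

end

end

theorem mainTheorem1: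
  "\<exists>mech :: ('b, 's) mechanism.
     is_mechanism mech \<and> DSIC mech \<and> IR mech \<and> WBB mech \<and>
     (\<forall>N M E f B v (G :: 's \<Rightarrow> real measure).
        valid_market N M E f \<and> (\<forall>i\<in>N. 0 \<le> B i) \<and> (\<forall>i\<in>N. 0 < v i) \<and>
        (\<forall>j\<in>M. positive_distribution (G j)) \<longrightarrow>
        (ennreal (1/4) * (\<integral>\<^sup>+ \<rho>. ennreal (LW_OPT N M E f B v \<rho>) \<partial>(PiM M G))
           \<le> (\<integral>\<^sup>+ z. ennreal (liquid_welfare N M E f B v (fst z)
                  (fst (mech N M E f B v (fst z) (snd z)))) \<partial>(PiM M G \<Otimes>\<^sub>M PiM M G))) \<and>
        (ennreal (1/2) * (\<integral>\<^sup>+ \<rho>. ennreal (LW_OPT N M E f B v \<rho>) \<partial>(PiM M G))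
           \<le> (\<integral>\<^sup>+ z. ennreal (social_welfare N M E f v (fst z)
                  (fst (mech N M E f B v (fst z) (snd z)))) \<partial>(PiM M G \<Otimes>\<^sub>M PiM M G))))"
proof (intro exI[of _ clearing_mech] conjI allI impI clearing_mech_feasible clearing_mech_DSIC
    clearing_mech_IR clearing_mech_WBB; elim conjE)
  fix N :: "'b set" and M E f B v and G :: "'s \<Rightarrow> real measure"
  assume asm: "valid_market N M E f" "\<forall>i\<in>N. 0 \<le> (B i :: real)" "\<forall>i\<in>N. 0 < (v i :: real)"
    "\<forall>j\<in>M. positive_distribution (G j)"
  then have "market N M E f B" by (simp add: market_def)
  note market.expected_liquid_welfare[OF this, of v G] market.expected_social_welfare[OF this, of v G]
  with asm show
    "ennreal (1/4) * (\<integral>\<^sup>+ \<rho>. ennreal (LW_OPT N M E f B v \<rho>) \<partial>(PiM M G))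
       \<le> (\<integral>\<^sup>+ z. ennreal (liquid_welfare N M E f B v (fst z)
              (fst (clearing_mech N M E f B v (fst z) (snd z)))) \<partial>(PiM M G \<Otimes>\<^sub>M PiM M G))"
    "ennreal (1/2) * (\<integral>\<^sup>+ \<rho>. ennreal (LW_OPT N M E f B v \<rho>) \<partial>(PiM M G))
       \<le> (\<integral>\<^sup>+ z. ennreal (social_welfare N M E f v (fst z)
              (fst (clearing_mech N M E f B v (fst z) (snd z)))) \<partial>(PiM M G \<Otimes>\<^sub>M PiM M G))"
    by auto
qed

end
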